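(* Let $\gamma,\eta,\lambda\in\mathbb{R}$, $a\in\mathbb{C}$, $k\in\mathbb{Z}$, $m\in\mathbb{N}$ and $n\in\mathbb{N}_0$. Then $$\mathfrak{B}_{n,a}^{[m-1]}(\eta;\lambda)=\sum_{j=0}^{n}\binom{n}{j}\,\mathfrak{b}_{j}^{(k)}(-\gamma)\;{}_{\mathfrak{B}}\mathfrak{D}_{n-j,a}^{[k,m-1]}(\gamma,\eta;\lambda),$$ where $\mathfrak{B}_{n,a}^{[m-1]}$ are the generalized Apostol-Bernoulli polynomials, $\mathfrak{b}_j^{(k)}$ the poly-Bernoulli polynomials of the second kind, and ${}_{\mathfrak{B}}\mathfrak{D}_{n,a}^{[k,m-1]}$ the generalized Apostol-Bernoulli poly-Daehee polynomials.
   Context: $\mathbb{N}=\{1,2,\dots\}$, $\mathbb{N}_0=\mathbb{N}\cup\{0\}$. The polylogarithm is $\mathrm{Li}_k(z)=\sum_{r=1}^{\infty} z^r/r^k$. Generalized Apostol-Bernoulli poly-Daehee polynomials (GABPDP), defined by the generating function $$(1+x)^{\gamma}\,\frac{\log(1+x)}{\mathrm{Li}_k(1-e^{-x})}\,e^{\eta x}\left(\frac{x^m}{\lambda e^x-\sum_{l=0}^{m-1}\frac{x^l}{l!}}\right)^{a}=\sum_{n=0}^\infty {}_{\mathfrak{B}}\mathfrak{D}_{n,a}^{[k,m-1]}(\gamma,\eta;\lambda)\frac{x^n}{n!}.$$ Generalized Apostol-Bernoulli polynomials of order $a\in\mathbb{C}$: $$e^{\eta x}\left(\frac{x^m}{\lambda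 e^x-\sum_{l=0}^{m-1}\frac{x^l}{l!}}\right)^{a}=\sum_{n=0}^\infty\mathfrak{B}_{n,a}^{[m-1]}(\eta;\lambda)\frac{x^n}{n!}.$$ Poly-Bernoulli polynomials of the second kind: $(1+x)^{\gamma}\frac{\mathrm{Li}_k(1-e^{-x})}{\log(1+x)}=\sum_{n=0}^\infty\mathfrak{b}_n^{(k)}(\gamma)\frac{x^n}{n!}$. *)

theory Defs
  imports "HOL-Analysis.Analysis" "HOL-Computational_Algebra.Formal_Power_Series"
begin

text \<open>
  Generating functions are formal power series over the complex numbers. On such series
  \<^term>\<open>F / G\<close> is the exact quotient whenever \<open>G \<noteq> 0\<close> and \<open>subdegree G \<le> subdegree F\<close>,
  which holds for all quotients below with \<open>m \<ge> 1\<close> (see the \<open>subdegree\<close> lemmas), so the removable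
  singularities at the origin need no special treatment.
\<close>

text \<open>The numbers \<open>c n\<close> with \<open>F(x) = (\<Sum>n. c n * x ^ n / fact n)\<close>.\<close>

definition egf_coeff :: "complex fps \<Rightarrow> nat \<Rightarrow> complex" where
  "egf_coeff F n = fact n * fps_nth F n"

lemma egf_coeff_iff:
  "egf_coeff F = c \<longleftrightarrow> F = Abs_fps (\<lambda>n. c n / fact n)"
  by (auto simp: egf_coeff_def fps_eq_iff fun_eq_iff field_simps)

text \<open>
  Complex powers of a power series. Write \<open>f = x ^ d * c * (1 + h)\<close> with \<open>d = subdegree f\<close>,
  \<open>c \<noteq> 0\<close> and \<open>h(0) = 0\<close>; then \<open>f ^ a = x ^ (d a) * c powr a * (\<Sum>n. (a gchoose n) * h ^ n)\<close>,
  with the principal branch for the constant \<open>c powr a\<close>. This is a power series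
  only if \<open>d a\<close> is a natural number: no condition on \<open>a\<close> if \<open>f(0) \<noteq> 0\<close>, and satisfied by every
  natural number \<open>a\<close>. In the remaining cases no value is specified.
\<close>

definition fps_cpow :: "complex fps \<Rightarrow> complex \<Rightarrow> complex fps" where
  "fps_cpow f a =
     (if \<exists>N. of_nat N = of_nat (subdegree f) * a then
        let N = (THE N. of_nat N = of_nat (subdegree f) * a);
            u = unit_factor f;
            c = fps_nth u 0
        in fps_X ^ N * fps_const (c powr a) *
             (fps_binomial a oo (fps_const (inverse c) * u - 1))
      else undefined)"

text \<open>\<open>lam e^x - (\<Sum>l<m. x^l / l!)\<close>\<close>

definition apostol_denom :: "nat \<Rightarrow> real \<Rightarrow> complex fps" where
  "apostol_denom m lam =
     fps_const (of_real lam) * fps_exp 1 - (\<Sum>l<m. fps_const (1 / fact l) * fps_X ^ l)"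

definition apostol_gf :: "nat \<Rightarrow> complex \<Rightarrow> real \<Rightarrow> real \<Rightarrow> complex fps" where
  "apostol_gf m a \<eta> lam =
     fps_exp (of_real \<eta>) * fps_cpow (fps_X ^ m / apostol_denom m lam) a"

definition polylog_fps :: "int \<Rightarrow> complex fps" where
  "polylog_fps k = Abs_fps (\<lambda>r. if r = 0 then 0 else 1 / of_nat r powi k)"

text \<open>\<open>Li_k(1 - e^(-x))\<close>\<close>

definition polylog_exp :: "int \<Rightarrow> complex fps" where
  "polylog_exp k = polylog_fps k oo (1 - fps_exp (- 1))"

text \<open>\<^term>\<open>fps_ln 1\<close> is the series of \<open>log (1 + x)\<close>, and \<^term>\<open>fps_binomial \<gamma>\<close> that of \<open>(1 + x)^\<gamma>\<close>.\<close>

text \<open>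
  The index written \<open>[m - 1]\<close> in the literature is represented by \<open>m \<ge> 1\<close> itself; \<open>a\<close> is the order.
  GABPDP abbreviates ``generalized Apostol--Bernoulli poly-Daehee polynomials''.
\<close>

definition gen_apostol_bernoulli :: "nat \<Rightarrow> complex \<Rightarrow> nat \<Rightarrow> real \<Rightarrow> real \<Rightarrow> complex" where
  "gen_apostol_bernoulli m a n \<eta> lam = egf_coeff (apostol_gf m a \<eta> lam) n"

definition poly_bernoulli_2nd :: "int \<Rightarrow> nat \<Rightarrow> real \<Rightarrow> complex" where
  "poly_bernoulli_2nd k j \<gamma> =
     egf_coeff (fps_binomial (of_real \<gamma>) * (polylog_exp k / fps_ln 1)) j"

definition GABPDP :: "int \<Rightarrow> nat \<Rightarrow> complex \<Rightarrow> nat \<Rightarrow> real \<Rightarrow> real \<Rightarrow> real \<Rightarrow> complex" where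
  "GABPDP k m a n \<gamma> \<eta> lam =
     egf_coeff (fps_binomial (of_real \<gamma>) * (fps_ln 1 / polylog_exp k) * apostol_gf m a \<eta> lam) n"

lemma subdegree_fps_ln_1: "subdegree (fps_ln 1 :: complex fps) = 1"
  by (rule subdegreeI) (auto simp: fps_ln_def)

lemma subdegree_polylog_exp: "subdegree (polylog_exp k) = 1"
proof (rule subdegreeI)
  show "fps_nth (polylog_exp k) 1 \<noteq> 0"
    by (simp add: polylog_exp_def polylog_fps_def fps_compose_nth)
qed (simp add: polylog_exp_def polylog_fps_def fps_compose_nth)

lemma apostol_denom_nth:
  "fps_nth (apostol_denom m lam) n = (of_real lam - (if n < m then 1 else 0)) / fact n"
proof -
  have "(\<Sum>l<m. (1 / fact l) * (if n = l then 1 else (0::complex)))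
          = (\<Sum>l<m. if l = n then 1 / fact n else 0)"
    by (intro sum.cong) auto
  thus ?thesis
    by (auto simp: apostol_denom_def fps_sum_nth diff_divide_distrib)
qed

lemma subdegree_apostol_denom:
  assumes "m \<ge> 1"
  shows "subdegree (apostol_denom m lam) = (if lam = 1 then m else 0)"
  using assms by (intro subdegreeI) (auto simp: apostol_denom_nth split: if_splits)

lemma fps_cpow_of_nat:
  assumes "f \<noteq> 0"
  shows "fps_cpow f (of_nat n) = f ^ n"
proof -
  define d where "d = subdegree f"
  define u where "u = unit_factor f"
  define c where "c = fps_nth u 0"
  have c: "c \<noteq> 0" using assms by (simp add: c_def u_def)
  have N: "(of_nat N = of_nat d * (of_nat n :: complex)) \<longleftrightarrow> N = d * n" for N
    by (metis of_nat_eq_iff of_nat_mult)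
  have "fps_binomial (of_nat n) oo (fps_const (inverse c) * u - 1)
          = (fps_const (inverse c) * u) ^ n"
    using c by (simp add: fps_binomial_of_nat fps_compose_power[symmetric]
        fps_compose_add_distrib c_def)
  hence "fps_cpow f (of_nat n)
           = fps_X ^ (d * n) * fps_const (c ^ n) * (fps_const (inverse c) * u) ^ n"
    using c unfolding fps_cpow_def Let_def d_def[symmetric] u_def[symmetric] c_def[symmetric] N
    by (simp add: powr_nat')
  also have "\<dots> = (fps_X ^ d * (fps_const c * fps_const (inverse c)) * u) ^ n"
    by (simp add: power_mult_distrib power_mult fps_const_power mult_ac del: fps_const_mult)
  also have "\<dots> = f ^ n"
    using c fps_unit_factor_decompose'[of f] by (simp add: d_def u_def)
  finally show ?thesis .
qed

end

theory Submission
  imports Defs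
begin

text \<open>The generating function of \<open>GABPDP\<close> is \<open>apostol_gf\<close> times the
  factor (1+x)^\<gamma> log(1+x)/Li_k(1-e^(-x)), and that of \<open>poly_bernoulli_2nd\<close> at
  -\<gamma> is the inverse of this factor. Their product is therefore \<open>apostol_gf\<close>, and
  the binomial convolution \<open>egf_coeff_mult\<close> turns this into the sum. The inverse
  relation rests on \<open>fps_divide_mult_swap\<close> and
  \<open>fps_binomial_uminus_mult\<close>.\<close>

lemma egf_coeff_mult:
  "egf_coeff (F * G) n = (\<Sum>j=0..n. of_nat (n choose j) * egf_coeff F j * egf_coeff G (n - j))"
  unfolding egf_coeff_def fps_mult_nth sum_distrib_left
  by (intro sum.cong refl) (simp add: binomial_fact)

text \<open>Neither series need be a unit, but equal subdegrees make each divide the other, so both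
  quotients are exact. Multiplying by \<open>F * G\<close> and cancelling it in the integral domain
  of power series gives the identity.\<close>

lemma fps_divide_mult_swap:
  fixes F G :: "'a::field fps"
  assumes "F \<noteq> 0" "G \<noteq> 0" "subdegree F = subdegree G"
  shows "(F / G) * (G / F) = 1"
proof -
  have "G dvd F" "F dvd G"
    using assms by (simp_all add: fps_dvd_iff)
  then have "((F / G) * (G / F)) * (F * G) = 1 * (F * G)"
    by (metis dvd_div_mult_self mult.assoc mult.commute mult_1)
  then show ?thesis
    using assms by simp
qed

lemma fps_binomial_uminus_mult: "fps_binomial (- c) * fps_binomial c = (1 :: 'a::field_char_0 fps)"
  by (simp flip: fps_binomial_add_mult)

theorem theorem2p5:
  fixes \<gamma> \<eta> lam :: real and a :: complex and k :: int and m n :: nat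
  assumes "m \<ge> 1"
  shows "gen_apostol_bernoulli m a n \<eta> lam =
           (\<Sum>j=0..n. of_nat (n choose j) * poly_bernoulli_2nd k j (- \<gamma>)
                        * GABPDP k m a (n - j) \<gamma> \<eta> lam)"
proof -
  let ?L = "fps_ln 1 :: complex fps" and ?P = "polylog_exp k"
  let ?B = "\<lambda>c. fps_binomial (of_real c) :: complex fps"
  have "?L \<noteq> 0" "?P \<noteq> 0"
    using subdegree_fps_ln_1 subdegree_polylog_exp[of k] by auto
  \<comment> \<open>Both series vanish at the origin to order exactly 1.\<close>
  then have "(?P / ?L) * (?L / ?P) = 1"
    by (intro fps_divide_mult_swap) (simp_all add: subdegree_fps_ln_1 subdegree_polylog_exp)
  moreover have "?B (- \<gamma>) * ?B \<gamma> = 1"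
    by (simp add: fps_binomial_uminus_mult)
  ultimately have "apostol_gf m a \<eta> lam =
      (?B (- \<gamma>) * ?B \<gamma>) * ((?P / ?L) * (?L / ?P)) * apostol_gf m a \<eta> lam"
    by simp
  \<comment> \<open>Regrouped into the two generating functions; the left factor receives the index
    \<open>j\<close> of the convolution, the right one \<open>n - j\<close>.\<close>
  also have "\<dots> = (?B (- \<gamma>) * (?P / ?L)) * (?B \<gamma> * (?L / ?P) * apostol_gf m a \<eta> lam)"
    by (simp only: mult_ac)
  finally show ?thesis
    unfolding gen_apostol_bernoulli_def poly_bernoulli_2nd_def GABPDP_def
    by (metis egf_coeff_mult)
qed

end
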